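(* Let $G'=(V,E')$ be a communication graph as described in the context, and let $G_{\min}=(V,E_{\min})$ be the subgraph of $G'$ such that, for $(u,v)\in E'$, $(u,v)\in E_{\min}$ iff there is no path $r$ from $u$ to $v$ in $G'$ with $|r|>1$ and $C(r)\le C(u,v)$. Then a subgraph $G=(V,E)$ of $G'$ (with $E\subseteq E'$) has the minimum-energy property if and only if it contains $G_{\min}$ as a subgraph (i.e. $E_{\min}\subseteq E$). Thus $G_{\min}$ is the smallest subgraph of $G'$ with the minimum-energy property.
   Context: Setting: $V$ is a finite set of nodes located at pairwise distinct points of the plane; $d(u,v)$ is the Euclidean distance between nodes $u,v$. Fix constants $t>0$, $n\ge 2$ and $c>0$. Transmitting from $u$ to $v$ takes power $p(u,v)=t\,d(u,v)^n$; a reception takes power $c$. $G'=(V,E')$ is a directed graph without self-loops, where $(u,v)\in E'$ means that $u$ can transmit to $v$ when $u$ uses the maximum power $p_{max}$; thus $(u,v)\in E'$ implies $t\,d(u,v)^n\le p_{max}$, but the converse is not assumed. $G'$ is assumed (strongly) connected: for every pair of nodes $u,v$ there is a path in $G'$ from $u$ to $v$. A path $r=(u_0,\dots,u_k)$ in a graph $(V,E)$ is an ordered list of nodes with $(u_i,u_{i+1})\in E$ for all $0\le i<k$; its length is $|r|=k$. Its cost (total power consumption) is $C(r)=\sum_{i=0}^{k-1}\bigl(p(u_i,u_{i+1})+c\bigr)$; $C(u,v)$ denotes the cost of the path $(u,v)$. A path $r$ in $G'$ from $u$ to $v$ is a minimum-energy path if $C(r)\le C(r')$ for all paths $r'$ in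 $G'$ from $u$ to $v$. A subgraph $G=(V,E)$ of $G'$ has the minimum-energy property if for all $u,v\in V$ there is a path $r$ in $G$ that is a minimum-energy path in $G'$ from $u$ to $v$. *)

theory Defs
  imports
    "HOL-Analysis.Analysis"
    "Graph_Theory.Pair_Digraph"
    "Graph_Theory.Digraph_Component_Vwalk"
begin

definition tx_power :: "('a \<Rightarrow> real^2) \<Rightarrow> real \<Rightarrow> real \<Rightarrow> 'a \<Rightarrow> 'a \<Rightarrow> real" where
  "tx_power loc t n u v = t * dist (loc u) (loc v) powr n"

(* A path is a vertex walk: a nonempty list of nodes, repetitions allowed, whose
   length is its number of edges (vwalk_length). The list [u] is the path of
   length 0 from u to u. *)
definition path_cost :: "('a \<Rightarrow> real^2) \<Rightarrow> real \<Rightarrow> real \<Rightarrow> real \<Rightarrow> 'a vwalk \<Rightarrow> real" where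
  "path_cost loc t n c r =
     (\<Sum>i<vwalk_length r. (tx_power loc t n (r ! i) (r ! Suc i) + c))"

definition path_from_to :: "'a pair_pre_digraph \<Rightarrow> 'a \<Rightarrow> 'a vwalk \<Rightarrow> 'a \<Rightarrow> bool" where
  "path_from_to G u r v \<longleftrightarrow> vwalk r (with_proj G) \<and> hd r = u \<and> last r = v"

definition minimum_energy_path ::
  "('a \<Rightarrow> real^2) \<Rightarrow> real \<Rightarrow> real \<Rightarrow> real \<Rightarrow> 'a pair_pre_digraph \<Rightarrow> 'a \<Rightarrow> 'a vwalk \<Rightarrow> 'a \<Rightarrow> bool" where
  "minimum_energy_path loc t n c G' u r v \<longleftrightarrow>
     path_from_to G' u r v \<and>
     (\<forall>r'. path_from_to G' u r' v \<longrightarrow> path_cost loc t n c r \<le> path_cost loc t n c r')"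

definition minimum_energy_property ::
  "('a \<Rightarrow> real^2) \<Rightarrow> real \<Rightarrow> real \<Rightarrow> real \<Rightarrow> 'a pair_pre_digraph \<Rightarrow> 'a pair_pre_digraph \<Rightarrow> bool" where
  "minimum_energy_property loc t n c G' G \<longleftrightarrow>
     (\<forall>u\<in>pverts G'. \<forall>v\<in>pverts G'. \<exists>r.
        path_from_to G u r v \<and> minimum_energy_path loc t n c G' u r v)"

definition G_min ::
  "('a \<Rightarrow> real^2) \<Rightarrow> real \<Rightarrow> real \<Rightarrow> real \<Rightarrow> 'a pair_pre_digraph \<Rightarrow> 'a pair_pre_digraph" where
  "G_min loc t n c G' =
     \<lparr> pverts = pverts G',
       parcs = {(u, v). (u, v) \<in> parcs G' \<and>
         \<not> (\<exists>r. path_from_to G' u r v \<and> vwalk_length r > 1 \<and>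
                path_cost loc t n c r \<le> path_cost loc t n c [u, v])} \<rparr>"

(* pair_digraph: finite and without self-loops. Connectivity is spelled out rather
   than taken from strongly_connected, which also excludes the empty node set. *)
locale communication_graph = pair_digraph G'
  for G' :: "'a pair_pre_digraph" +
  fixes loc :: "'a \<Rightarrow> real^2" and t n c p_max :: real
  assumes distinct_locations: "inj_on loc (pverts G')"
    and t_pos: "t > 0"
    and n_ge_2: "n \<ge> 2"
    and c_pos: "c > 0"
    and power_le_max: "(u, v) \<in> parcs G' \<Longrightarrow> tx_power loc t n u v \<le> p_max"
    and paths_exist: "u \<in> pverts G' \<Longrightarrow> v \<in> pverts G' \<Longrightarrow> \<exists>r. path_from_to G' u r v"

end

theory Submission
  imports Defs
begin

text \<open>
  Every hop costs at least \<open>c > 0\<close>, so only finitely many paths are as cheap as a given one;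
  hence minimum-energy paths exist, and among them there is one with the most hops. Such a path
  runs inside \<open>G_min\<close>: an arc outside \<open>G_min\<close> could be replaced by a detour with more hops
  and no larger cost. Conversely, for an arc \<open>(u, v)\<close> of \<open>G_min\<close> every minimum-energy path
  from \<open>u\<close> to \<open>v\<close> has at most one hop, and as \<open>u \<noteq> v\<close> it is the arc itself.
\<close>

text \<open>The three walks overlap in the single nodes \<open>hd q\<close> and
  \<open>last q\<close>, so the outer arcs depend on \<open>q\<close> only through its endpoints.
  Exchanging \<open>q\<close> for another walk with the same ends leaves them unchanged.\<close>

lemma vwalk_arcs_splice:
  assumes "q \<noteq> []"
  shows "vwalk_arcs (xs @ q @ ys) =
    vwalk_arcs (xs @ [hd q]) @ vwalk_arcs q @ vwalk_arcs (last q # ys)"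
proof -
  have "vwalk_arcs (q @ ys) = vwalk_arcs q @ vwalk_arcs (last q # ys)"
    \<comment> \<open>An arc linking two concatenated lists exists only if both are
      nonempty.\<close>
    using assms by (cases "ys = []") (simp_all add: vwalk_arcs_append)
  then show ?thesis
    using assms by (cases "xs = []") (simp_all add: vwalk_arcs_append)
qed

lemma vwalk_arc_split:
  "(u, v) \<in> set (vwalk_arcs r) \<Longrightarrow> \<exists>xs ys. r = xs @ [u, v] @ ys"
proof (induction r rule: vwalk_arcs.induct)
  case (3 x y r)
  show ?case
  proof (cases "(u, v) = (x, y)")
    case True
    then have "x # y # r = [] @ [u, v] @ r"
      by simp
    then show ?thesis
      by blast
  next
    case False
    then obtain xs ys where "y # r = xs @ [u, v] @ ys"
      using 3 by auto
    then have "x # y # r = (x # xs) @ [u, v] @ ys"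
      by simp
    then show ?thesis
      by blast
  qed
qed auto

text \<open>Summing over the arc list instead of positions turns concatenation of arc lists into
  addition of costs.\<close>

lemma path_cost_eq_sum_list:
  "path_cost loc t n c r = (\<Sum>(u, v)\<leftarrow>vwalk_arcs r. tx_power loc t n u v + c)"
proof (induction r rule: vwalk_arcs.induct)
  case (3 x y r)
  then show ?case
    by (simp add: path_cost_def sum.lessThan_Suc_shift del: sum.lessThan_Suc)
qed (simp_all add: path_cost_def)

lemma path_cost_splice:
  assumes "q \<noteq> []"
  shows "path_cost loc t n c (xs @ q @ ys) = path_cost loc t n c (xs @ [hd q])
    + path_cost loc t n c q + path_cost loc t n c (last q # ys)"
  by (simp add: path_cost_eq_sum_list vwalk_arcs_splice[OF assms])

lemma path_from_to_splice:
  assumes "path_from_to G a (xs @ [u, v] @ ys) b" and "path_from_to G u q v"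
  shows "path_from_to G a (xs @ q @ ys) b"
proof -
  have q: "q \<noteq> []" "hd q = u" "last q = v"
    using assms(2) by (auto simp: path_from_to_def)
  have "vwalk (xs @ q @ ys) (with_proj G)"
    \<comment> \<open>Splitting both walks gives the same outer arcs; only the middle arc is
      exchanged for those of \<open>q\<close>.\<close>
    using assms q vwalk_arcs_splice[of q xs ys] vwalk_arcs_splice[of "[u, v]" xs ys]
    by (auto simp: path_from_to_def vwalk_def)
  then show ?thesis
    using assms(1) q by (auto simp: path_from_to_def hd_append last_append split: if_splits)
qed

context communication_graph
begin

abbreviation cost :: "'a vwalk \<Rightarrow> real" where
  "cost \<equiv> path_cost loc t n c"

abbreviation min_path :: "'a \<Rightarrow> 'a vwalk \<Rightarrow> 'a \<Rightarrow> bool" where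
  "min_path \<equiv> minimum_energy_path loc t n c G'"

text \<open>Transmission power is nonnegative, so the reception power alone bounds each hop from
  below.\<close>

lemma hop_cost_le_path_cost: "c * real (vwalk_length r) \<le> cost r"
proof -
  have "(\<Sum>i<vwalk_length r. c) \<le> cost r"
    unfolding path_cost_def using t_pos by (intro sum_mono) (simp add: tx_power_def)
  then show ?thesis
    by (simp add: mult.commute)
qed

lemma finite_paths_cost_le: "finite {r. path_from_to G' u r v \<and> cost r \<le> b}"
proof (rule finite_subset)
  show "{r. path_from_to G' u r v \<and> cost r \<le> b}
    \<subseteq> {r. set r \<subseteq> pverts G' \<and> length r \<le> Suc (nat \<lceil>b / c\<rceil>)}"
  proof clarsimp
    fix r assume r: "path_from_to G' u r v" and b: "cost r \<le> b"
    have "c * real (vwalk_length r) \<le> b"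
      using hop_cost_le_path_cost b by (rule order_trans)
    then have "real (vwalk_length r) \<le> b / c"
      using c_pos by (simp add: field_simps)
    then have "vwalk_length r \<le> nat \<lceil>b / c\<rceil>"
      by linarith
    then show "set r \<subseteq> pverts G' \<and> length r \<le> Suc (nat \<lceil>b / c\<rceil>)"
      using r by (auto simp: path_from_to_def vwalk_def)
  qed
qed (rule finite_lists_length_le[OF pair_finite_verts])

lemma ex_minimum_energy_path:
  assumes "u \<in> pverts G'" "v \<in> pverts G'"
  shows "\<exists>r. min_path u r v"
proof -
  obtain r0 where r0: "path_from_to G' u r0 v"
    using paths_exist assms by blast
  define S where "S = {r. path_from_to G' u r v \<and> cost r \<le> cost r0}"
  have "finite S" "S \<noteq> {}"
    using r0 finite_paths_cost_le by (auto simp: S_def)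
  then obtain r where "r \<in> S" "\<And>r'. r' \<in> S \<Longrightarrow> cost r \<le> cost r'"
    using arg_min_if_finite(1) arg_min_least by metis
  \<comment> \<open>Paths outside \<open>S\<close> cost more than \<open>r0\<close>, hence more than
    \<open>r\<close>.\<close>
  then have "min_path u r v"
    by (fastforce simp: S_def minimum_energy_path_def)
  then show ?thesis ..
qed

lemma ex_longest_minimum_energy_path:
  assumes "u \<in> pverts G'" "v \<in> pverts G'"
  shows "\<exists>r. min_path u r v \<and> (\<forall>r'. min_path u r' v \<longrightarrow> length r' \<le> length r)"
proof -
  obtain r0 where r0: "min_path u r0 v"
    using ex_minimum_energy_path assms by blast
  \<comment> \<open>Every minimum-energy path costs at most as much as \<open>r0\<close>.\<close>
  have "finite {r. min_path u r v}"
    using r0 by (intro finite_subset[OF _ finite_paths_cost_le[of u v "cost r0"]])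
      (auto simp: minimum_energy_path_def)
  then have "\<forall>r. min_path u r v \<longrightarrow> length r < Suc (Max (length ` {r. min_path u r v}))"
    by (auto simp: less_Suc_eq_le)
  then show ?thesis
    using ex_has_greatest_nat[of "\<lambda>r. min_path u r v", OF r0] by blast
qed

lemma longest_minimum_energy_path_in_G_min:
  assumes r: "min_path u r v"
    and longest: "\<And>r'. min_path u r' v \<Longrightarrow> length r' \<le> length r"
  shows "path_from_to (G_min loc t n c G') u r v"
proof -
  have path: "path_from_to G' u r v"
    using r by (simp add: minimum_energy_path_def)
  have "(a, b) \<in> parcs (G_min loc t n c G')" if ab: "(a, b) \<in> set (vwalk_arcs r)" for a b
  proof (rule ccontr)
    assume "(a, b) \<notin> parcs (G_min loc t n c G')"
    moreover have "(a, b) \<in> parcs G'"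
      using ab path by (auto simp: path_from_to_def vwalk_def)
    ultimately obtain q where q: "path_from_to G' a q b" "vwalk_length q > 1"
      "cost q \<le> cost [a, b]"
      by (auto simp: G_min_def)
    obtain xs ys where split: "r = xs @ [a, b] @ ys"
      using vwalk_arc_split[OF ab] by blast
    have q': "q \<noteq> []" "hd q = a" "last q = b"
      using q(1) by (auto simp: path_from_to_def)
    \<comment> \<open>The outer costs agree, so the change in cost is
      \<open>cost q - cost [a, b]\<close>, which is not positive.\<close>
    have "cost (xs @ q @ ys) \<le> cost r"
      using path_cost_splice[of q loc t n c xs ys]
        path_cost_splice[of "[a, b]" loc t n c xs ys] q(3) q' by (simp add: split)
    moreover have "path_from_to G' u (xs @ q @ ys) v"
      using path_from_to_splice path q(1) by (simp only: split)
    ultimately have "min_path u (xs @ q @ ys) v"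
      using r by (fastforce simp: minimum_energy_path_def)
    \<comment> \<open>More than one hop means at least three nodes, so the detour is strictly longer
      than \<open>r\<close>.\<close>
    then show False
      using longest q(2) by (fastforce simp: split)
  qed
  then show ?thesis
    using path by (auto simp: path_from_to_def vwalk_def G_min_def)
qed

lemma minimum_energy_property_G_min:
  "minimum_energy_property loc t n c G' (G_min loc t n c G')"
  unfolding minimum_energy_property_def
  using ex_longest_minimum_energy_path longest_minimum_energy_path_in_G_min by blast

lemma spanning_G_min: "spanning (with_proj (G_min loc t n c G')) (with_proj G')"
proof -
  have "pair_wf_digraph (G_min loc t n c G')"
    by unfold_locales (auto simp: G_min_def dest: in_arcsD1 in_arcsD2)
  then show ?thesis
    using pair_wf_digraph
    by (auto simp: spanning_def subgraph_def wf_digraph_wp_iff) (auto simp: G_min_def)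
qed

text \<open>Minimality is measured in \<open>G'\<close> alone, so the optimal walks of
  \<open>G_min\<close> serve unchanged in any graph containing it.\<close>

lemma minimum_energy_property_if_G_min_subgraph:
  assumes "subgraph (with_proj (G_min loc t n c G')) (with_proj G)"
  shows "minimum_energy_property loc t n c G' G"
  using minimum_energy_property_G_min vwalkI_subgraph[OF _ assms]
  unfolding minimum_energy_property_def path_from_to_def by blast

lemma G_min_subgraph_if_minimum_energy_property:
  assumes "spanning (with_proj G) (with_proj G')"
    and "minimum_energy_property loc t n c G' G"
  shows "subgraph (with_proj (G_min loc t n c G')) (with_proj G)"
proof -
  have "(u, v) \<in> parcs G" if uv: "(u, v) \<in> parcs (G_min loc t n c G')" for u v
  proof -
    have arc: "(u, v) \<in> parcs G'"
      using uv by (simp add: G_min_def)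
    then have verts: "u \<in> pverts G'" "v \<in> pverts G'" and "u \<noteq> v"
      using in_arcsD1 in_arcsD2 no_loops' by auto
    obtain r where r: "path_from_to G u r v" "min_path u r v"
      using assms(2) verts by (auto simp: minimum_energy_property_def)
    \<comment> \<open>The arc itself competes with \<open>r\<close>, so \<open>r\<close> costs no
      more and would exclude the arc from \<open>G_min\<close> if it had several hops.\<close>
    have "path_from_to G' u [u, v] v"
      using arc verts by (auto simp: path_from_to_def vwalk_def)
    then have "path_from_to G' u r v" "cost r \<le> cost [u, v]"
      using r(2) by (auto simp: minimum_energy_path_def)
    then have "\<not> vwalk_length r > 1"
      using uv by (auto simp: G_min_def)
    moreover have "r \<noteq> []" "hd r = u" "last r = v"
      using r(1) by (auto simp: path_from_to_def)
    \<comment> \<open>At most one hop leaves one or two nodes, and a single node would force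
      \<open>u = v\<close>.\<close>
    ultimately have "r = [u, v]"
      using \<open>u \<noteq> v\<close> by (cases r; cases "tl r") auto
    then show ?thesis
      using r(1) by (simp add: path_from_to_def vwalk_def)
  qed
  then show ?thesis
    using assms(1) spanning_G_min by (auto simp: spanning_def subgraph_def)
qed

end

theorem mainTheorem1:
  fixes G' :: "'a pair_pre_digraph"
    and loc :: "'a \<Rightarrow> real^2"
    and t n c p_max :: real
  assumes "communication_graph G' loc t n c p_max"
  shows "(\<forall>G :: 'a pair_pre_digraph. spanning (with_proj G) (with_proj G') \<longrightarrow>
            (minimum_energy_property loc t n c G' G \<longleftrightarrow>
             subgraph (with_proj (G_min loc t n c G')) (with_proj G)))
       \<and> spanning (with_proj (G_min loc t n c G')) (with_proj G')
       \<and> minimum_energy_property loc t n c G' (G_min loc t n c G')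
       \<and> (\<forall>G :: 'a pair_pre_digraph. spanning (with_proj G) (with_proj G') \<and>
            minimum_energy_property loc t n c G' G \<longrightarrow>
            subgraph (with_proj (G_min loc t n c G')) (with_proj G))"
proof -
  interpret communication_graph G' loc t n c p_max
    by (rule assms)
  show ?thesis
    using spanning_G_min minimum_energy_property_G_min
      minimum_energy_property_if_G_min_subgraph G_min_subgraph_if_minimum_energy_property
    by blast
qed

end
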